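(* Let $X$ be any set and let $A$ and $B$ be nonempty disjoint subsets of $X$. Then there exists a total order $\preceq$ on $X$ such that $$\forall x,y\in X\ \left[(x\in A \text{ and } y\in B)\implies x\preceq y\right].$$
   Context: A total order (linear order) on $X$ is a reflexive, antisymmetric, transitive relation $\preceq$ on $X$ in which any two elements are comparable. *)

theory Defs
  imports Main
begin

end

theory Submission
  imports Defs
begin

text \<open>Any linear order on \<open>X\<close> (the well-ordering theorem supplies one) can be
  rearranged into the ordered sum of its restrictions to \<open>X - B\<close> and \<open>B\<close>.
  By disjointness \<open>A\<close> lies in the lower block.\<close>

theorem proposition6:
  fixes X A B :: "'a set"
  assumes "A \<subseteq> X" and "B \<subseteq> X"
    and "A \<noteq> {}" and "B \<noteq> {}"
    and "A \<inter> B = {}"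
  shows "\<exists>r. linear_order_on X r \<and>
    (\<forall>x\<in>X. \<forall>y\<in>X. x \<in> A \<and> y \<in> B \<longrightarrow> (x, y) \<in> r)"
proof -
  obtain s where "well_order_on X s"
    using well_order_on by blast
  then have s: "s \<subseteq> X \<times> X" "refl_on X s" "trans s" "antisym s" "total_on X s"
    by (simp_all add: order_on_defs)
  \<comment> \<open>Stack the two blocks: keep s inside X - B and inside B, with X - B placed below B.\<close>
  define r where "r = {(x, y) \<in> s. x \<in> B \<longleftrightarrow> y \<in> B} \<union> (X - B) \<times> B"
  have "r \<subseteq> X \<times> X"
    using s(1) assms(2) by (auto simp: r_def)
  moreover have "refl_on X r"
    using s(2) by (auto simp: r_def refl_on_def)
  \<comment> \<open>Along a chain, membership in \<open>B\<close> can only switch from false to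
    true. Without a switch, \<open>trans s\<close> applies; with one, the endpoints lie in
    \<open>(X - B) \<times> B\<close>, as \<open>s\<close> stays within \<open>X\<close>.\<close>
  moreover have "trans r"
    using s(1,3) unfolding r_def trans_def by blast
  moreover have "antisym r"
    using s(4) by (auto simp: r_def antisym_def)
  moreover have "total_on X r"
    using s(5) by (auto simp: r_def total_on_def)
  ultimately have "linear_order_on X r"
    by (simp add: order_on_defs)
  moreover have "\<forall>x\<in>X. \<forall>y\<in>X. x \<in> A \<and> y \<in> B \<longrightarrow> (x, y) \<in> r"
    using assms(5) by (auto simp: r_def)
  ultimately show ?thesis
    by blast
qed

end
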